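(* Let $l,r\in\mathbb{N}$ satisfy $l\le r$. Then $$\sum_{i=0}^{l-1}\frac{\binom{2r}{i}\binom{l-1}{i}}{\binom{2r-l}{i}}=\frac{(2r)!}{2\,r!\,r!\,\binom{2r-l}{r}}.$$
   Context: $\mathbb{N}=\{1,2,3,\dots\}$, and $\binom{\cdot}{\cdot}$ denotes the ordinary binomial coefficient. *)

theory Defs
  imports Complex_Main
begin

end

theory Submission
  imports Defs "HOL-Computational_Algebra.Formal_Power_Series"
begin

text \<open>With \<open>l = n + 1\<close> and \<open>r = n + k\<close>, the sum is, up to a factor independent of \<open>i\<close>, the
  coefficient of \<open>x ^ n\<close> in \<open>(1 + x) ^ (2n + 2k) / (1 - x) ^ (2k)\<close>. For fixed \<open>k\<close> this coefficient
  satisfies a first-order recurrence in \<open>n\<close>: the two sides of the recurrence differ by the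
  coefficient of \<open>x ^ n\<close> in \<open>x K' - n K\<close> for a suitable series \<open>K\<close>, which vanishes.\<close>

lemma fps_nth_inverse_one_minus_X_power:
  "fps_nth (inverse (1 - fps_X) ^ Suc d :: real fps) j = real ((d + j) choose j)"
  using one_minus_const_fps_X_neg_power' [of "Suc d" "1 :: real"]
  by (simp add: fps_inverse_power del: power_Suc)

definition ratio_fps :: "nat \<Rightarrow> nat \<Rightarrow> real fps"
  where "ratio_fps n k = (1 + fps_X) ^ (2 * n + 2 * k) * inverse (1 - fps_X) ^ (2 * k)"

lemma fps_nth_ratio_fps:
  "fps_nth (ratio_fps n (Suc j)) n
    = (\<Sum>i=0..n. real ((2 * n + 2 * Suc j) choose i) * real ((2 * j + 1 + (n - i)) choose (n - i)))"
proof -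
  have "fps_nth ((1 + fps_X) ^ m :: real fps) i = real (m choose i)" for m i
    by (simp add: fps_binomial_of_nat [symmetric] binomial_gbinomial)
  then show ?thesis
    \<comment> \<open>With \<open>k = Suc j\<close> the pole has order
      \<open>2 * k = Suc (2 * j + 1)\<close>, which fits the negative binomial expansion.\<close>
    using fps_nth_inverse_one_minus_X_power [of "2 * j + 1"]
    by (simp add: ratio_fps_def fps_mult_nth del: power_Suc)
qed

text \<open>The left side is the coefficient of \<open>x ^ n\<close> in the derivative of
  \<open>ratio_fps (Suc n) k\<close>; that derivative is compared with a multiple of
  \<open>ratio_fps n k\<close>.\<close>

lemma ratio_fps_recurrence:
  assumes "k > 0"
  shows "real (n + 1) * fps_nth (ratio_fps (Suc n) k) (Suc n)
    = (4 * n + 4 * k + 2) * fps_nth (ratio_fps n k) n"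
proof -
  define w where "w = (inverse (1 - fps_X) :: real fps)"
  define a where "a = (1 + fps_X :: real fps)"
  \<comment> \<open>This choice gives
    \<open>H1' = (4 * n + 4 * k + 2) * H + (x * K' - n * K)\<close> for
    \<open>H = ratio_fps n k\<close> and \<open>H1 = ratio_fps (Suc n) k\<close>.\<close>
  define K where "K = 2 * a * ratio_fps n k"
  obtain j where k: "2 * k = Suc j" using assms by (cases "2 * k") auto
  have w: "w * (1 - fps_X) = 1"
    unfolding w_def by (rule inverse_mult_eq_1) simp
  have dw: "fps_deriv w = w\<^sup>2"
    unfolding w_def by (subst fps_inverse_deriv) auto
  have da: "fps_deriv (a ^ Suc m) = of_nat (Suc m) * a ^ m" for m
    unfolding fps_deriv_power' by (simp add: a_def)
  have dwk: "fps_deriv (w ^ (2 * k)) = of_nat (2 * k) * w ^ (2 * k) * w"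
    unfolding k fps_deriv_power' dw by (simp add: power2_eq_square algebra_simps)
  have H: "ratio_fps n k = a ^ (2 * n + 2 * k) * w ^ (2 * k)"
    and H': "ratio_fps (Suc n) k = a ^ Suc (2 * n + 2 * k + 1) * w ^ (2 * k)"
    by (simp_all add: ratio_fps_def a_def w_def)
  have "fps_deriv (ratio_fps (Suc n) k) =
     ratio_fps n k * (of_nat (2 * n + 2 * k + 2) * a + of_nat (2 * k) * a\<^sup>2 * w)"
    unfolding H H' fps_deriv_mult dwk da
    by (simp add: power2_eq_square algebra_simps)
  moreover have "fps_deriv K = 
     ratio_fps n k * (2 * of_nat (2 * n + 2 * k + 1) + 2 * of_nat (2 * k) * a * w)"
  proof -
    have "K = 2 * (a ^ Suc (2 * n + 2 * k) * w ^ (2 * k))"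
      by (simp add: K_def H algebra_simps)
    then have "fps_deriv K = 2 * fps_deriv (a ^ Suc (2 * n + 2 * k) * w ^ (2 * k))"
      by (simp del: power_Suc)
    then show ?thesis
      unfolding H fps_deriv_mult dwk da
      by (simp add: algebra_simps)
  qed
  \<comment> \<open>This is the same identity with the common factor \<open>ratio_fps n k\<close>
    divided out.\<close>
  moreover have "of_nat (2 * n + 2 * k + 2) * a + of_nat (2 * k) * a\<^sup>2 * w 
    = of_nat (4 * n + 4 * k + 2)
      + fps_X * (2 * of_nat (2 * n + 2 * k + 1) + 2 * of_nat (2 * k) * a * w) - of_nat n * (2 * a)"
  proof -
    \<comment> \<open>One factor \<open>a\<close> is split as \<open>2 * x + (1 - x)\<close>, and
      \<open>1 - x\<close> cancels \<open>w\<close>.\<close>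
    have "a\<^sup>2 * w = 2 * fps_X * a * w + a * (w * (1 - fps_X))"
      by (simp add: a_def power2_eq_square algebra_simps)
    then have "a\<^sup>2 * w = 2 * fps_X * a * w + a" 
      by (simp only: w mult_1_right)
    then have "of_nat (2 * k) * a\<^sup>2 * w = of_nat (2 * k) * (2 * fps_X * a * w + a)"
      by (simp only: mult.assoc)
    then show ?thesis
      by (simp add: a_def algebra_simps)
  qed
  ultimately have "fps_deriv (ratio_fps (Suc n) k)
    = of_nat (4 * n + 4 * k + 2) * ratio_fps n k + (fps_X * fps_deriv K - of_nat n * K)"
    by (simp only:) (simp add: K_def algebra_simps)
  then have "fps_nth (fps_deriv (ratio_fps (Suc n) k)) n
    = fps_nth (of_nat (4 * n + 4 * k + 2) * ratio_fps n k) n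
      + fps_nth (fps_X * fps_deriv K - of_nat n * K) n"
    by simp
  \<comment> \<open>The operator \<open>x * d/dx\<close> multiplies the coefficient of
    \<open>x ^ n\<close> by \<open>n\<close>.\<close>
  moreover have "fps_nth (fps_X * fps_deriv K - of_nat n * K) n = 0"
    by (cases n) (simp_all add: fps_of_nat [symmetric] del: of_nat_Suc)
  ultimately show ?thesis
    by (simp add: fps_of_nat [symmetric] del: of_nat_Suc of_nat_add of_nat_mult)
qed

lemma fps_nth_ratio_fps_closed_form:
  "fps_nth (ratio_fps n (Suc j)) n
    = fact (2 * n + 2 * Suc j) * fact j / (2 * fact (n + Suc j) * fact n * fact (2 * j + 1))"
proof (induction n)
  case 0
  show ?case
    by (simp add: fps_nth_ratio_fps)
next
  case (Suc n)
  \<comment> \<open>In terms of \<open>m\<close> the factorials shift by explicit successors; their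
    ratio is \<open>(2 * m + 4) * (2 * m + 3) / ((m + 2) * (n + 1))\<close>, that is
    \<open>(4 * m + 6) / (n + 1)\<close>.\<close>
  define m where "m = n + j"
  have "2 * Suc n + 2 * Suc j = Suc (Suc (2 * m + 2))" "2 * n + 2 * Suc j = 2 * m + 2"
    "Suc n + Suc j = Suc (Suc m)" "n + Suc j = Suc m"
    by (simp_all add: m_def)
  note m = this
  have "(fact (2 * Suc n + 2 * Suc j) * fact j 
      / (2 * fact (Suc n + Suc j) * fact (Suc n) * fact (2 * j + 1)) :: real)
    = (4 * n + 4 * Suc j + 2) / (n + 1) * (fact (2 * n + 2 * Suc j) * fact j 
      / (2 * fact (n + Suc j) * fact n * fact (2 * j + 1)))"
    unfolding m fact_Suc [of "Suc (2 * m + 2)"] fact_Suc [of "2 * m + 2"] fact_Suc [of "Suc m"] fact_Suc [of n]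
    by (simp add: divide_simps m_def del: fact_Suc) (simp add: algebra_simps del: fact_Suc)
  moreover have "fps_nth (ratio_fps (Suc n) (Suc j)) (Suc n)
    = (4 * n + 4 * Suc j + 2) / (n + 1) * fps_nth (ratio_fps n (Suc j)) n"
    using ratio_fps_recurrence [of "Suc j" n] by (simp add: field_simps)
  ultimately show ?case
    unfolding Suc.IH by simp
qed

theorem lemma2p5:
  fixes l r :: nat
  assumes "1 \<le> l" and "l \<le> r"
  shows "(\<Sum>i=0..l-1. real ((2 * r) choose i) * real ((l - 1) choose i) / real ((2 * r - l) choose i))
    = fact (2 * r) / (2 * fact r * fact r * real ((2 * r - l) choose r))"
proof -
  define n j where "n = l - 1" and "j = r - l"
  have l: "l - 1 = n" and r: "r = n + Suc j" and rl: "2 * r - l = n + 2 * j + 1"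
    using assms by (auto simp: n_def j_def)
  \<comment> \<open>The factor independent of \<open>i\<close>: the reciprocal of
    \<open>(n + 2 * j + 1) choose n\<close>.\<close>
  define c :: real where "c = fact n * fact (2 * j + 1) / fact (n + 2 * j + 1)"
  have "real ((2 * r) choose i) * real (n choose i) / real ((n + 2 * j + 1) choose i)
      = c * (real ((2 * n + 2 * Suc j) choose i) * real ((2 * j + 1 + (n - i)) choose (n - i)))"
    if "i \<le> n" for i
  proof -
    have "n + 2 * j + 1 - i = 2 * j + 1 + (n - i)" using that by simp
    then have "real (n choose i) / real ((n + 2 * j + 1) choose i)
        = c * real ((2 * j + 1 + (n - i)) choose (n - i))"
      using that by (simp add: binomial_fact c_def field_simps del: fact_Suc)
    moreover have "2 * r = 2 * n + 2 * Suc j" by (simp add: r)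
    ultimately show ?thesis
      by (simp only: times_divide_eq_right [symmetric] mult.left_commute)
  qed
  then have "(\<Sum>i=0..n. real ((2 * r) choose i) * real (n choose i) / real ((n + 2 * j + 1) choose i))
    = c * fps_nth (ratio_fps n (Suc j)) n"
    unfolding fps_nth_ratio_fps sum_distrib_left
    by (intro sum.cong) auto
  also have "\<dots> = fact (2 * r) / (2 * fact r * fact r * real ((n + 2 * j + 1) choose r))"
  proof -
    \<comment> \<open>In the product, \<open>fact n\<close> and \<open>fact (2 * j + 1)\<close>
      cancel; the remaining \<open>fact j / fact (n + 2 * j + 1)\<close> is the reciprocal of this
      binomial times \<open>fact r\<close>.\<close>
    have "real ((n + 2 * j + 1) choose r) = fact (n + 2 * j + 1) / (fact r * fact j)"
      by (subst binomial_fact) (auto simp: r)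
    moreover have "2 * n + 2 * Suc j = 2 * r" "n + Suc j = r" by (simp_all add: r)
    ultimately show ?thesis
      by (simp only: fps_nth_ratio_fps_closed_form c_def) (simp add: field_simps del: fact_Suc)
  qed
  finally show ?thesis
    unfolding l rl .
qed

end
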